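(* Let $k\ge1$ and $N\ge k$ be integers. For any $\sigma,\tau\in\mathcal{P}(k)$, $$\mathring{\mathrm{Wg}}_k(\sigma,\tau,N)=\sum_{j=\#(\sigma\wedge\tau)}^{k}\Biggl(\sum_{\substack{\pi\in\mathcal{P}(k),\ \pi\le\sigma\wedge\tau\\ \#\pi=j}}\mu(\pi,\sigma)\,\mu(\pi,\tau)\Biggr)\sum_{i=0}^{j-|D(\sigma\vee\tau)|}\binom{j-|D(\sigma\vee\tau)|}{i}N^{-i}\,a_{j-i}(N).$$
   Context: $\mathcal{P}(k)$ is the lattice of set partitions of $[k]=\{1,\dots,k\}$, ordered by refinement: $\pi_1\le\pi_2$ iff every block of $\pi_1$ is contained in a block of $\pi_2$; $\wedge$ and $\vee$ are meet and join. $\#\pi$ is the number of blocks of $\pi$, and $D(\pi)=\{j\in[k]:\{j\}\text{ is a block of }\pi\}$. For $\pi_1\le\pi_2$, if the blocks $B_1,\dots,B_r$ of $\pi_2$ are split into $\lambda_1,\dots,\lambda_r$ blocks of $\pi_1$ respectively, then $\mu(\pi_1,\pi_2)=\prod_{i=1}^{r}(-1)^{\lambda_i-1}(\lambda_i-1)!$. $(x)_n=x(x-1)\cdots(x-n+1)$ with $(x)_0=1$. The centered Weingarten function is $$\mathring{\mathrm{Wg}}_k(\sigma,\tau,N)=\sum_{i=0}^{|D(\sigma\vee\tau)|}\binom{|D(\sigma\vee\tau)|}{i}(-1)^i\sum_{\pi\in\mathcal{P}(k),\ \pi\le\sigma\wedge\tau}\mu(\pi,\sigma)\,\mu(\pi,\tau)\,N^{-i}\,\frac{1}{(N)_{\#\pi-i}}.$$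 For $0\le m\le N$, $a_m(N)=\frac{1}{N!}\sum_{g\in S_N}\prod_{r=1}^{m}\bigl(g_{rr}-\frac1N\bigr)=\sum_{l=0}^{m}\binom{m}{l}\frac{1}{(N)_l}(-N)^{-(m-l)}$, where $g\in S_N$ is identified with its permutation matrix ($g_{rs}=1$ if $g(r)=s$, and $0$ otherwise). *)

theory Defs
  imports Complex_Main "HOL-Library.Disjoint_Sets" "HOL-Combinatorics.Permutations"
    "HOL-Algebra.Lattice"
begin

definition partition_lattice :: "nat \<Rightarrow> nat set set gorder" where
  "partition_lattice k =
     \<lparr>carrier = {\<pi>. partition_on {1..k} \<pi>}, eq = (=), le = refines {1..k}\<rparr>"

lemma partition_lattice_simps [simp]:
  "carrier (partition_lattice k) = {\<pi>. partition_on {1..k} \<pi>}"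
  "x .=\<^bsub>partition_lattice k\<^esub> y \<longleftrightarrow> x = y"
  "x \<sqsubseteq>\<^bsub>partition_lattice k\<^esub> y \<longleftrightarrow> refines {1..k} x y"
  by (simp_all add: partition_lattice_def)

lemma partial_order_partition_lattice: "partial_order (partition_lattice k)"
  by unfold_locales
    (auto simp: partition_lattice_def refines_refl dest: refines_asym intro: refines_trans)

lemma common_refinement_least_upper:
  assumes "partition_on {1..k} \<sigma>" "partition_on {1..k} \<tau>"
  shows "least (partition_lattice k)
           (common_refinement {\<rho>. refines {1..k} \<sigma> \<rho> \<and> refines {1..k} \<tau> \<rho>})
           (Upper (partition_lattice k) {\<sigma>, \<tau>})"
proof -
  let ?U = "{\<rho>. refines {1..k} \<sigma> \<rho> \<and> refines {1..k} \<tau> \<rho>}"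
  have top: "{{1..k}} - {{}} \<in> ?U"
  proof -
    have "refines {1..k} \<rho> ({{1..k}} - {{}})" if "partition_on {1..k} \<rho>" for \<rho>
      using that unfolding refines_def partition_on_def disjoint_def by auto
    then show ?thesis using assms by blast
  qed
  have part: "partition_on {1..k} \<rho>" if "\<rho> \<in> ?U" for \<rho>
    using that by (auto simp: refines_def)
  have cr: "partition_on {1..k} (common_refinement ?U)"
    by (rule partition_on_common_refinement) (use part top in blast)+
  have "refines {1..k} \<sigma> (common_refinement ?U)" "refines {1..k} \<tau> (common_refinement ?U)"
    by (rule common_refinement_coarsest; use part top assms in blast)+
  moreover have "refines {1..k} (common_refinement ?U) \<rho>" if "\<rho> \<in> ?U" for \<rho>
    by (rule refines_common_refinement) (use part that in auto)
  ultimately show ?thesis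
    using cr assms by (auto simp: least_def Upper_def)
qed

lemma common_refinement_greatest_lower:
  assumes "partition_on {1..k} \<sigma>" "partition_on {1..k} \<tau>"
  shows "greatest (partition_lattice k) (common_refinement {\<sigma>, \<tau>})
           (Lower (partition_lattice k) {\<sigma>, \<tau>})"
proof -
  have cr: "partition_on {1..k} (common_refinement {\<sigma>, \<tau>})"
    by (rule partition_on_common_refinement) (use assms in auto)
  have "refines {1..k} (common_refinement {\<sigma>, \<tau>}) \<rho>" if "\<rho> \<in> {\<sigma>, \<tau>}" for \<rho>
    by (rule refines_common_refinement) (use assms that in auto)
  moreover have "refines {1..k} \<rho> (common_refinement {\<sigma>, \<tau>})"
    if "refines {1..k} \<rho> \<sigma>" "refines {1..k} \<rho> \<tau>" for \<rho>
    by (rule common_refinement_coarsest) (use assms that in \<open>auto simp: refines_def\<close>)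
  ultimately show ?thesis
    using cr assms by (auto simp: greatest_def Lower_def)
qed

lemma lattice_partition_lattice: "lattice (partition_lattice k)"
proof -
  interpret partial_order "partition_lattice k" by (rule partial_order_partition_lattice)
  show ?thesis
  proof unfold_locales
    fix x y
    assume "x \<in> carrier (partition_lattice k)" "y \<in> carrier (partition_lattice k)"
    then have xy: "partition_on {1..k} x" "partition_on {1..k} y"
      by auto
    show "\<exists>s. least (partition_lattice k) s (Upper (partition_lattice k) {x, y})"
      using common_refinement_least_upper[OF xy] by (rule exI)
    show "\<exists>s. greatest (partition_lattice k) s (Lower (partition_lattice k) {x, y})"
      using common_refinement_greatest_lower[OF xy] by (rule exI)
  qed
qed

definition singleton_points :: "'a set set \<Rightarrow> 'a set" where
  "singleton_points \<pi> = {j. {j} \<in> \<pi>}"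

(* Meaningful for \<pi>1 \<le> \<pi>2, where card {C \<in> \<pi>1. C \<subseteq> B} \<ge> 1 is the number of
   blocks into which B is split. *)
definition partition_mu :: "'a set set \<Rightarrow> 'a set set \<Rightarrow> real" where
  "partition_mu \<pi>1 \<pi>2 =
     (\<Prod>B\<in>\<pi>2. let l = card {C \<in> \<pi>1. C \<subseteq> B} in (-1) ^ (l - 1) * fact (l - 1))"

definition ffact :: "real \<Rightarrow> nat \<Rightarrow> real" where
  "ffact x n = (\<Prod>i<n. x - real i)"

(* The natural-number subtraction card \<pi> - i never truncates: a singleton block of
   \<sigma> \<squnion> \<tau> is a singleton block of every \<pi> \<sqsubseteq> \<sigma> \<sqinter> \<tau>, so i \<le> card \<pi>. *)
definition centered_Wg :: "nat \<Rightarrow> nat set set \<Rightarrow> nat set set \<Rightarrow> nat \<Rightarrow> real" where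
  "centered_Wg k \<sigma> \<tau> N =
     (let L = partition_lattice k; d = card (singleton_points (\<sigma> \<squnion>\<^bsub>L\<^esub> \<tau>)) in
      \<Sum>i=0..d. real (d choose i) * (-1) ^ i *
        (\<Sum>\<pi> | \<pi> \<in> carrier L \<and> \<pi> \<sqsubseteq>\<^bsub>L\<^esub> \<sigma> \<sqinter>\<^bsub>L\<^esub> \<tau>.
           partition_mu \<pi> \<sigma> * partition_mu \<pi> \<tau> * real N powi (- int i) *
           (1 / ffact (real N) (card \<pi> - i))))"

definition perm_matrix_entry :: "(nat \<Rightarrow> nat) \<Rightarrow> nat \<Rightarrow> nat \<Rightarrow> real" where
  "perm_matrix_entry g r s = (if g r = s then 1 else 0)"

(* a_m(N), for m \<le> N; S_N is the set of permutations of {1..N}. *)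
definition centered_diag_moment :: "nat \<Rightarrow> nat \<Rightarrow> real" where
  "centered_diag_moment m N =
     1 / fact N * (\<Sum>g | g permutes {1..N}. \<Prod>r=1..m. perm_matrix_entry g r r - 1 / real N)"

end

theory Submission
  imports Defs
begin

text \<open>
  Write \<open>X\<^sub>r = g\<^sub>r\<^sub>r\<close> for the diagonal entries of a uniformly random permutation matrix,
  \<open>d\<close> for the number of singleton blocks of \<open>\<sigma> \<squnion> \<tau>\<close> and \<open>j\<close> for the number of blocks of
  \<open>\<pi>\<close>. Both sides of the theorem are sums over \<open>\<pi> \<sqsubseteq> \<sigma> \<sqinter> \<tau>\<close> with the same weight
  \<open>\<mu>(\<pi>,\<sigma>) \<mu>(\<pi>,\<tau>)\<close>, so it suffices to compare the factors multiplying this weight, and these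
  are two expansions of one mixed moment, the average of
  \<open>(\<Prod>r=1..d. X\<^sub>r - 1/N) * (\<Prod>r=d+1..j. X\<^sub>r)\<close>.
  Multiplying out the \<open>d\<close> centered factors leaves plain moments, where a product of \<open>l\<close> entries
  averages to the probability \<open>1 / (N)\<^sub>l\<close> that \<open>l\<close> given points are fixed; this
  gives the factor in the centered Weingarten function. Writing each of the \<open>j - d\<close> plain factors
  as \<open>(X\<^sub>r - 1/N) + 1/N\<close> and multiplying out leaves centered moments \<open>a\<^sub>m(N)\<close> and gives the
  factor on the right-hand side.

  Each expansion has binomial coefficients because the moments involved depend only on the number
  of indices, not on their choice; \<open>average_prod_shift\<close> is the resulting expansion rule. It is used
  once more to see that the centered moments inherit this exchangeability from the plain ones
  (\<open>average_prod_centered\<close>). The mixed moment makes sense only when \<open>d \<le> j \<le> N\<close>: here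
  \<open>j \<le> k \<le> N\<close>, and \<open>d \<le> j\<close> because a singleton block of \<open>\<sigma> \<squnion> \<tau>\<close> remains a block
  in every finer partition.
\<close>

section \<open>Moments of the diagonal of a random permutation matrix\<close>

definition perm_average :: "nat \<Rightarrow> ((nat \<Rightarrow> nat) \<Rightarrow> real) \<Rightarrow> real" where
  "perm_average N F = 1 / fact N * (\<Sum>g | g permutes {1..N}. F g)"

lemma perm_average_sum:
  "perm_average N (\<lambda>g. \<Sum>i\<in>I. F i g) = (\<Sum>i\<in>I. perm_average N (F i))"
  unfolding perm_average_def by (subst sum.swap) (simp add: sum_distrib_left)

lemma perm_average_cmult: "perm_average N (\<lambda>g. c * F g) = c * perm_average N F"
  unfolding perm_average_def by (simp add: sum_distrib_left mult_ac)

lemma sum_Pow_by_card: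
  fixes h :: "nat \<Rightarrow> real"
  assumes "finite A"
  shows "(\<Sum>T\<in>Pow A. h (card T)) = (\<Sum>i=0..card A. real (card A choose i) * h i)"
proof -
  have "(\<Sum>T\<in>Pow A. h (card T)) = (\<Sum>i\<in>{0..card A}. \<Sum>T | T \<in> Pow A \<and> card T = i. h (card T))"
    using assms by (intro sum.group[symmetric]) (auto intro: card_mono)
  also have "\<dots> = (\<Sum>i=0..card A. real (card A choose i) * h i)"
    using n_subsets[OF assms] by (intro sum.cong) auto
  finally show ?thesis .
qed

text \<open>
  The expansion of \<open>\<Prod>\<^sub>A (Y + c)\<close> has one term for every subset \<open>T\<close> of \<open>A\<close> on which the constant
  is chosen; by exchangeability of \<open>Y\<close> its average depends only on \<open>|T|\<close>.
\<close>

lemma average_prod_shift: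
  assumes exch: "\<And>S. S \<subseteq> {1..N} \<Longrightarrow> perm_average N (\<lambda>g. \<Prod>r\<in>S. Y g r) = \<phi> (card S)"
    and AB: "A \<subseteq> {1..N}" "B \<subseteq> {1..N}" "A \<inter> B = {}"
  shows "perm_average N (\<lambda>g. (\<Prod>r\<in>A. Y g r + c) * (\<Prod>r\<in>B. Y g r)) =
    (\<Sum>i=0..card A. real (card A choose i) * (c ^ i * \<phi> (card A + card B - i)))"
proof -
  have fin: "finite A" "finite B"
    using AB finite_subset by blast+
  have expand: "(\<Prod>r\<in>A. Y g r + c) * (\<Prod>r\<in>B. Y g r) =
      (\<Sum>T\<in>Pow A. c ^ card T * (\<Prod>r\<in>(A - T) \<union> B. Y g r))" for g
  proof -
    have "(\<Prod>r\<in>A. Y g r + c) = (\<Sum>T\<in>Pow A. c ^ card T * (\<Prod>r\<in>A - T. Y g r))"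
      using prod_add[OF fin(1), of "\<lambda>_. c" "Y g"] by (simp add: add.commute)
    moreover have "(\<Prod>r\<in>(A - T) \<union> B. Y g r) = (\<Prod>r\<in>A - T. Y g r) * (\<Prod>r\<in>B. Y g r)" for T
      using fin AB by (intro prod.union_disjoint) auto
    ultimately show ?thesis
      by (simp add: sum_distrib_right mult.assoc)
  qed
  have "perm_average N (\<lambda>g. (\<Prod>r\<in>A. Y g r + c) * (\<Prod>r\<in>B. Y g r)) =
      (\<Sum>T\<in>Pow A. c ^ card T * perm_average N (\<lambda>g. \<Prod>r\<in>(A - T) \<union> B. Y g r))"
    by (simp add: expand perm_average_sum perm_average_cmult)
  also have "\<dots> = (\<Sum>T\<in>Pow A. c ^ card T * \<phi> (card A + card B - card T))"
  proof (rule sum.cong[OF refl])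
    fix T assume T: "T \<in> Pow A"
    have "card ((A - T) \<union> B) = card (A - T) + card B"
      using fin AB by (intro card_Un_disjoint) auto
    also have "\<dots> = card A + card B - card T"
      using T fin by (simp add: card_Diff_subset finite_subset card_mono)
    finally show "c ^ card T * perm_average N (\<lambda>g. \<Prod>r\<in>(A - T) \<union> B. Y g r) =
        c ^ card T * \<phi> (card A + card B - card T)"
      using exch[of "(A - T) \<union> B"] AB by auto
  qed
  also have "\<dots> = (\<Sum>i=0..card A. real (card A choose i) * (c ^ i * \<phi> (card A + card B - i)))"
    by (rule sum_Pow_by_card[OF fin(1)])
  finally show ?thesis .
qed

lemma fact_eq_ffact_mult: "n \<le> N \<Longrightarrow> fact N = ffact (real N) n * fact (N - n)"
proof (induction n)
  case (Suc n)
  then have "fact (N - n) = (real N - real n) * fact (N - Suc n)"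
    by (subst fact_reduce) (auto simp: of_nat_diff)
  with Suc show ?case
    by (simp add: ffact_def mult.assoc)
qed (simp add: ffact_def)

text \<open>
  The product is the indicator of the permutations fixing \<open>S\<close> pointwise, that is, of the
  permutations of the complement of \<open>S\<close>.
\<close>

lemma average_prod_diagonal:
  assumes S: "S \<subseteq> {1..N}"
  shows "perm_average N (\<lambda>g. \<Prod>r\<in>S. perm_matrix_entry g r r) = 1 / ffact (real N) (card S)"
proof -
  have fin: "finite S"
    using S finite_subset by blast
  have le: "card S \<le> N"
    using card_mono[OF _ S] by simp
  have fixing: "{g. g permutes {1..N} \<and> (\<forall>r\<in>S. g r = r)} = {g. g permutes ({1..N} - S)}"
  proof (intro Collect_cong iffI conjI ballI; (elim conjE)?)
    fix g assume g: "g permutes {1..N}" "\<forall>r\<in>S. g r = r"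
    show "g permutes ({1..N} - S)"
      by (rule permutes_superset[OF g(1)]) (use g(2) in blast)
  next
    fix g assume g: "g permutes ({1..N} - S)"
    show "g permutes {1..N}"
      by (rule permutes_subset[OF g]) blast
    show "g r = r" if "r \<in> S" for r
      using permutes_not_in[OF g, of r] that by blast
  qed
  have "(\<Prod>r\<in>S. perm_matrix_entry g r r) = (if \<forall>r\<in>S. g r = r then 1 else 0)" for g
    using fin by (cases "\<forall>r\<in>S. g r = r") (simp_all add: perm_matrix_entry_def prod_zero_iff)
  then have "(\<Sum>g | g permutes {1..N}. \<Prod>r\<in>S. perm_matrix_entry g r r) =
      real (card {g. g permutes {1..N} \<and> (\<forall>r\<in>S. g r = r)})"
    by (simp add: sum.If_cases finite_permutations Collect_conj_eq)
  also have "\<dots> = fact (N - card S)"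
    unfolding fixing using S fin by (subst card_permutations) (auto simp: card_Diff_subset)
  finally show ?thesis
    unfolding perm_average_def using fact_eq_ffact_mult[OF le] by simp
qed

text \<open>
  Expanding the product expresses its average through the exchangeable plain moments and
  \<open>card S\<close> alone, so \<open>S\<close> may be replaced by \<open>{1..card S}\<close>.
\<close>

lemma average_prod_centered:
  assumes S: "S \<subseteq> {1..N}"
  shows "perm_average N (\<lambda>g. \<Prod>r\<in>S. perm_matrix_entry g r r - 1 / real N) =
    centered_diag_moment (card S) N"
proof -
  let ?X = "\<lambda>g r. perm_matrix_entry g r r" and ?c = "1 / real N"
  have expand: "perm_average N (\<lambda>g. \<Prod>r\<in>T. ?X g r - ?c) = (\<Sum>i=0..card T.
      real (card T choose i) * ((- ?c) ^ i * (1 / ffact (real N) (card T - i))))"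
    if "T \<subseteq> {1..N}" for T
    using average_prod_shift[OF average_prod_diagonal that empty_subsetI Int_empty_right, of "- ?c"]
    by simp
  have "{1..card S} \<subseteq> {1..N}"
    using card_mono[OF _ S] by auto
  from expand[OF S] expand[OF this] show ?thesis
    by (simp add: centered_diag_moment_def perm_average_def)
qed

text \<open>
  The two sides are the expansions of the moment with \<open>A = {1..d}\<close> centered and \<open>B = {d<..j}\<close>
  plain factors.
\<close>

lemma mixed_moment_expansions:
  assumes "d \<le> j" "j \<le> N"
  shows "(\<Sum>i=0..d. real (d choose i) * (-1) ^ i * real N powi (- int i) *
        (1 / ffact (real N) (j - i))) =
    (\<Sum>i=0..j - d. real ((j - d) choose i) * real N powi (- int i) *
        centered_diag_moment (j - i) N)"
proof -
  let ?X = "\<lambda>g r. perm_matrix_entry g r r" and ?c = "1 / real N"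
  let ?A = "{1..d}" and ?B = "{d<..j}"
  have sub: "?A \<subseteq> {1..N}" "?B \<subseteq> {1..N}" "?A \<inter> ?B = {}" "?B \<inter> ?A = {}"
    using assms by auto
  have pow: "real N powi (- int i) = ?c ^ i" for i
    by (simp add: power_int_minus power_one_over inverse_eq_divide)
  have "perm_average N (\<lambda>g. (\<Prod>r\<in>?A. ?X g r + (- ?c)) * (\<Prod>r\<in>?B. ?X g r)) =
      (\<Sum>i=0..d. real (d choose i) * ((- ?c) ^ i * (1 / ffact (real N) (j - i))))"
    using average_prod_shift[OF average_prod_diagonal sub(1-3), of "- ?c"] assms by simp
  moreover have "perm_average N (\<lambda>g. (\<Prod>r\<in>?B. ?X g r - ?c + ?c) * (\<Prod>r\<in>?A. ?X g r - ?c)) =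
      (\<Sum>i=0..j - d. real ((j - d) choose i) * (?c ^ i * centered_diag_moment (j - i) N))"
    using average_prod_shift[OF average_prod_centered sub(2,1,4), of ?c] assms by simp
  moreover have "(\<lambda>g. (\<Prod>r\<in>?A. ?X g r + (- ?c)) * (\<Prod>r\<in>?B. ?X g r)) =
      (\<lambda>g. (\<Prod>r\<in>?B. ?X g r - ?c + ?c) * (\<Prod>r\<in>?A. ?X g r - ?c))"
    by (simp add: mult.commute)
  ultimately have "(\<Sum>i=0..d. real (d choose i) * ((- ?c) ^ i * (1 / ffact (real N) (j - i)))) =
      (\<Sum>i=0..j - d. real ((j - d) choose i) * (?c ^ i * centered_diag_moment (j - i) N))"
    by metis
  then show ?thesis
    by (simp only: pow power_minus[of ?c] mult.assoc)
qed

section \<open>Block counts under refinement\<close>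

lemma card_partition_le:
  assumes "partition_on A P" "finite A"
  shows "card P \<le> card A"
proof (rule card_le_if_inj_on_rel[where r = "\<lambda>p x. x \<in> p"])
  show "\<exists>x. x \<in> A \<and> x \<in> p" if "p \<in> P" for p
  proof -
    from that have "p \<noteq> {}"
      using partition_onD3[OF assms(1)] by metis
    then show ?thesis
      using partition_onD1[OF assms(1)] that by blast
  qed
  show "p = q" if "p \<in> P" "q \<in> P" "x \<in> p" "x \<in> q" for p q x
    using partition_onD2[OF assms(1)] that by (auto simp: disjoint_def)
qed fact

lemma card_le_if_refines:
  assumes "refines A P Q" "finite A"
  shows "card Q \<le> card P"
proof (rule card_le_if_inj_on_rel[where r = "\<lambda>q p. p \<subseteq> q"])
  have P: "partition_on A P" and Q: "partition_on A Q"
    using assms(1) by (auto simp: refines_def)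
  show "finite P"
    using finite_elements[OF assms(2) P] .
  show "\<exists>p. p \<in> P \<and> p \<subseteq> q" if "q \<in> Q" for q
  proof -
    have "q \<noteq> {}"
      using that partition_onD3[OF Q] by auto
    moreover have "\<Union>{p \<in> P. p \<subseteq> q} = q"
      using partition_onD1[OF refines_obtains_subset[OF assms(1) that]] by simp
    ultimately show ?thesis by blast
  qed
  show "q = q'" if "q \<in> Q" "q' \<in> Q" "p \<in> P" "p \<subseteq> q" "p \<subseteq> q'" for q q' p
  proof -
    have "p \<noteq> {}"
      using that partition_onD3[OF P] by auto
    then have "q \<inter> q' \<noteq> {}"
      using that by blast
    then show ?thesis
      using disjointD[OF partition_onD2[OF Q]] that by blast
  qed
qed

text \<open>A singleton block cannot be split further, so it is also a block of the finer partition.\<close>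

lemma card_singleton_points_le:
  assumes "refines A P Q" "finite A"
  shows "card (singleton_points Q) \<le> card P"
proof (rule card_inj_on_le[where f = "\<lambda>x. {x}"])
  have P: "partition_on A P"
    using assms(1) by (auto simp: refines_def)
  show "finite P"
    using finite_elements[OF assms(2) P] .
  show "(\<lambda>x. {x}) ` singleton_points Q \<subseteq> P"
  proof clarify
    fix x assume "x \<in> singleton_points Q"
    then have "\<Union>{p \<in> P. p \<subseteq> {x}} = {x}"
      using partition_onD1[OF refines_obtains_subset[OF assms(1)]]
      by (simp add: singleton_points_def)
    then obtain p where "p \<in> P" "p \<subseteq> {x}" "x \<in> p" by blast
    then show "{x} \<in> P" by (metis empty_iff subset_singletonD)
  qed
qed simp

section \<open>The centered Weingarten function\<close>

theorem theorem3p6: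
  fixes k N :: nat and \<sigma> \<tau> :: "nat set set"
  assumes "k \<ge> 1" and "N \<ge> k"
    and "\<sigma> \<in> carrier (partition_lattice k)" and "\<tau> \<in> carrier (partition_lattice k)"
  shows "centered_Wg k \<sigma> \<tau> N =
    (\<Sum>j = card (\<sigma> \<sqinter>\<^bsub>partition_lattice k\<^esub> \<tau>)..k.
       (\<Sum>\<pi> | \<pi> \<in> carrier (partition_lattice k)
             \<and> \<pi> \<sqsubseteq>\<^bsub>partition_lattice k\<^esub> \<sigma> \<sqinter>\<^bsub>partition_lattice k\<^esub> \<tau> \<and> card \<pi> = j.
          partition_mu \<pi> \<sigma> * partition_mu \<pi> \<tau>) *
       (\<Sum>i = 0..j - card (singleton_points (\<sigma> \<squnion>\<^bsub>partition_lattice k\<^esub> \<tau>)).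
          real ((j - card (singleton_points (\<sigma> \<squnion>\<^bsub>partition_lattice k\<^esub> \<tau>))) choose i) *
          real N powi (- int i) * centered_diag_moment (j - i) N))"
proof -
  define L where "L = partition_lattice k"
  interpret lattice L
    unfolding L_def by (rule lattice_partition_lattice)
  define d where "d = card (singleton_points (\<sigma> \<squnion>\<^bsub>L\<^esub> \<tau>))"
  define P where "P = {\<pi>. \<pi> \<in> carrier L \<and> \<pi> \<sqsubseteq>\<^bsub>L\<^esub> \<sigma> \<sqinter>\<^bsub>L\<^esub> \<tau>}"
  define w where "w \<pi> = partition_mu \<pi> \<sigma> * partition_mu \<pi> \<tau>" for \<pi> :: "nat set set"
  define R where "R j = (\<Sum>i = 0..j - d. real ((j - d) choose i) * real N powi (- int i) *
    centered_diag_moment (j - i) N)" for j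
  have st: "\<sigma> \<in> carrier L" "\<tau> \<in> carrier L"
    using assms(3,4) by (simp_all add: L_def)
  have fin: "finite P"
    unfolding P_def L_def by (simp add: finitely_many_partition_on)
  have range: "card (\<sigma> \<sqinter>\<^bsub>L\<^esub> \<tau>) \<le> card \<pi>" "card \<pi> \<le> k" "d \<le> card \<pi>" if "\<pi> \<in> P" for \<pi>
  proof -
    from that have \<pi>: "\<pi> \<in> carrier L" and le: "\<pi> \<sqsubseteq>\<^bsub>L\<^esub> \<sigma> \<sqinter>\<^bsub>L\<^esub> \<tau>"
      by (auto simp: P_def)
    show "card (\<sigma> \<sqinter>\<^bsub>L\<^esub> \<tau>) \<le> card \<pi>"
      using card_le_if_refines[of "{1..k}" \<pi> "\<sigma> \<sqinter>\<^bsub>L\<^esub> \<tau>"] le by (simp add: L_def)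
    show "card \<pi> \<le> k"
      using card_partition_le[of "{1..k}" \<pi>] \<pi> by (simp add: L_def)
    have "\<pi> \<sqsubseteq>\<^bsub>L\<^esub> \<sigma>"
      using le_trans[OF le meet_left[OF st]] \<pi> st by simp
    then have "\<pi> \<sqsubseteq>\<^bsub>L\<^esub> \<sigma> \<squnion>\<^bsub>L\<^esub> \<tau>"
      using le_trans[OF _ join_left[OF st]] \<pi> st by simp
    then show "d \<le> card \<pi>"
      using card_singleton_points_le[of "{1..k}" \<pi> "\<sigma> \<squnion>\<^bsub>L\<^esub> \<tau>"] by (simp add: L_def d_def)
  qed
  have "centered_Wg k \<sigma> \<tau> N = (\<Sum>i=0..d. real (d choose i) * (-1) ^ i *
      (\<Sum>\<pi>\<in>P. w \<pi> * real N powi (- int i) * (1 / ffact (real N) (card \<pi> - i))))"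
    by (simp only: centered_Wg_def Let_def L_def[symmetric] d_def[symmetric] P_def[symmetric] w_def)
  also have "\<dots> = (\<Sum>\<pi>\<in>P. w \<pi> * (\<Sum>i=0..d. real (d choose i) * (-1) ^ i *
      real N powi (- int i) * (1 / ffact (real N) (card \<pi> - i))))"
    unfolding sum_distrib_left by (subst sum.swap) (simp add: mult_ac)
  also have "\<dots> = (\<Sum>\<pi>\<in>P. w \<pi> * R (card \<pi>))"
  proof (rule sum.cong[OF HOL.refl])
    fix \<pi> assume "\<pi> \<in> P"
    then have "d \<le> card \<pi>" "card \<pi> \<le> N"
      using range[of \<pi>] assms(2) by simp_all
    then show "w \<pi> * (\<Sum>i=0..d. real (d choose i) * (-1) ^ i *
        real N powi (- int i) * (1 / ffact (real N) (card \<pi> - i))) = w \<pi> * R (card \<pi>)"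
      unfolding R_def by (simp only: mixed_moment_expansions)
  qed
  also have "\<dots> = (\<Sum>j = card (\<sigma> \<sqinter>\<^bsub>L\<^esub> \<tau>)..k. \<Sum>\<pi> | \<pi> \<in> P \<and> card \<pi> = j. w \<pi> * R (card \<pi>))"
    using range by (intro sum.group[symmetric] fin) auto
  also have "\<dots> = (\<Sum>j = card (\<sigma> \<sqinter>\<^bsub>L\<^esub> \<tau>)..k. (\<Sum>\<pi> | \<pi> \<in> P \<and> card \<pi> = j. w \<pi>) * R j)"
    by (simp add: sum_distrib_right)
  also have "\<dots> = (\<Sum>j = card (\<sigma> \<sqinter>\<^bsub>L\<^esub> \<tau>)..k.
      (\<Sum>\<pi> | \<pi> \<in> carrier L \<and> \<pi> \<sqsubseteq>\<^bsub>L\<^esub> \<sigma> \<sqinter>\<^bsub>L\<^esub> \<tau> \<and> card \<pi> = j. w \<pi>) * R j)"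
    by (simp only: P_def mem_Collect_eq conj_assoc)
  finally show ?thesis
    by (simp only: R_def w_def d_def L_def)
qed

end
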